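(* Assume that $m(0)>0$, $|\mathbb P(0)|>0$, and that $(\gamma,\mu,\lambda,\kappa)$ satisfy $$\gamma\ge1,\quad \mu\ge0,\quad 2\mu+3\lambda\ge0,\quad \kappa\ge0 .$$ Then for the Cauchy problem (N) (see context) there is no classical solution $(\rho,u,\theta)\in D(\infty)$ with $$\limsup_{t\to\infty}|u(t,\cdot)|_{L^\infty(\mathbb R^3)}=0 .$$
   Context: Cauchy problem (N) on $\mathbb R^3$. Unknowns: density $\rho\ge0$, velocity $u$ ($\mathbb R^3$-valued), absolute temperature $\theta$: $$\rho_t+\mathrm{div}(\rho u)=0,\quad (\rho u)_t+\mathrm{div}(\rho u\otimes u)+\nabla P=\mathrm{div}\mathbb T,$$ $$(\rho\mathcal E)_t+\mathrm{div}(\rho\mathcal Eu+Pu)=\mathrm{div}(u\mathbb T)+\mathrm{div}(\kappa\nabla\theta),$$ with $P=R\rho\theta=(\gamma-1)\rho e=Ae^{S/c_v}\rho^\gamma$, $e=c_v\theta$, $c_v=R/(\gamma-1)$, constants $A,R>0$, $\mathcal E=e+\frac12|u|^2$, $\mathbb T=\mu(\nabla u+(\nabla u)^\top)+\lambda\,\mathrm{div}u\,\mathbb I_3$, and $\mu=\alpha\theta^\nu$, $\lambda=\beta\theta^\nu$, $\kappa=\daleth\theta^\nu$ with constants $\alpha,\beta,\daleth$ and $\nu>0$. (In the borderline case $\gamma=1$ read $P=R\rho\theta$, $e=c_v\theta$ with a positive constant $c_v$.) Initial data and far-field behavior, for some constant $\bar S$: $(\rho,u,S)|_{t=0}=(\rho_0>0,u_0,S_0)$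 on $\mathbb R^3$ and $(\rho,u,S)(t,x)\to(0,0,\bar S)$ as $|x|\to\infty$ for $t\ge0$. A classical solution in $(0,T]\times\mathbb R^3$ is one for which all derivatives appearing in the equations are continuous there and the equations hold pointwise. Notation: $m(t)=\int_{\mathbb R^3}\rho\,dx$ (total mass), $\mathbb P(t)=\int_{\mathbb R^3}\rho u\,dx$ (momentum), $E_k(t)=\frac12\int_{\mathbb R^3}\rho|u|^2dx$ (kinetic energy). Class $D(T)$: for $T>0$, a classical solution $(\rho,u,\theta)$ of (N) in $(0,T]\times\mathbb R^3$ is in $D(T)$ if $m(t),\mathbb P(t),E_k(t)$ all belong to $L^\infty([0,T])$; the total mass is conserved, $\frac{d}{dt}m(t)=0$ for any $t\in[0,T]$; and the momentum is conserved, $\frac{d}{dt}\mathbb P(t)=0$ for any $t\in[0,T]$. $D(\infty)$ denotes the solutions defined for all $t>0$ which belong to $D(T)$ for every $T>0$. *)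

theory Defs
  imports "HOL-Analysis.Analysis" "HOL-Probability.Essential_Supremum"
begin

section \<open>Calculus on space-time\<close>

type_synonym 'a spacetime = "real \<Rightarrow> real^3 \<Rightarrow> 'a"

text \<open>Time derivatives are taken within the time interval \<open>I\<close>, hence are one-sided at an endpoint
  belonging to \<open>I\<close>.\<close>

definition dt :: "real set \<Rightarrow> 'a::real_normed_vector spacetime \<Rightarrow> 'a spacetime" where
  "dt I f t x = vector_derivative (\<lambda>s. f s x) (at t within I)"

definition dx :: "3 \<Rightarrow> 'a::real_normed_vector spacetime \<Rightarrow> 'a spacetime" where
  "dx j f t x = vector_derivative (\<lambda>s. f t (x + s *\<^sub>R axis j 1)) (at 0)"

text \<open>Since \<^const>\<open>vector_derivative\<close> is total, existence of the derivative is demanded explicitly.\<close>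

definition has_cont_dt :: "real set \<Rightarrow> 'a::real_normed_vector spacetime \<Rightarrow> bool" where
  "has_cont_dt I f \<longleftrightarrow>
     (\<forall>t\<in>I. \<forall>x. (\<lambda>s. f s x) differentiable (at t within I)) \<and>
     continuous_on (I \<times> UNIV) (\<lambda>(t, x). dt I f t x)"

definition has_cont_dx :: "real set \<Rightarrow> 3 \<Rightarrow> 'a::real_normed_vector spacetime \<Rightarrow> bool" where
  "has_cont_dx I j f \<longleftrightarrow>
     (\<forall>t\<in>I. \<forall>x. (\<lambda>s. f t (x + s *\<^sub>R axis j 1)) differentiable (at 0)) \<and>
     continuous_on (I \<times> UNIV) (\<lambda>(t, x). dx j f t x)"

definition grad :: "real spacetime \<Rightarrow> (real^3) spacetime" where
  "grad f t x = (\<chi> j. dx j f t x)"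

definition grad_vec :: "(real^3) spacetime \<Rightarrow> (real^3^3) spacetime" where
  "grad_vec v t x = (\<chi> i j. dx j (\<lambda>t x. v t x $ i) t x)"

definition div_vec :: "(real^3) spacetime \<Rightarrow> real spacetime" where
  "div_vec v t x = (\<Sum>j\<in>UNIV. dx j (\<lambda>t x. v t x $ j) t x)"

definition div_mat :: "(real^3^3) spacetime \<Rightarrow> (real^3) spacetime" where
  "div_mat M t x = (\<chi> i. \<Sum>j\<in>UNIV. dx j (\<lambda>t x. M t x $ i $ j) t x)"

definition outer :: "real^3 \<Rightarrow> real^3 \<Rightarrow> real^3^3" where
  "outer a b = (\<chi> i j. a $ i * b $ j)"

section \<open>The full compressible Navier-Stokes system with degenerate viscosities\<close>

record viscous_gas =
  R_gas :: real
  A_gas :: real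
  gamma_gas :: real
  cv_gas :: real
  alpha_gas :: real
  beta_gas :: real
  daleth_gas :: real
  nu_gas :: real

text \<open>For \<open>\<gamma> = 1\<close> the formula \<open>c\<^sub>v = R / (\<gamma> - 1)\<close> is meaningless and \<open>c\<^sub>v\<close> is a free positive constant.\<close>

definition polytropic :: "viscous_gas \<Rightarrow> bool" where
  "polytropic g \<longleftrightarrow> R_gas g > 0 \<and> A_gas g > 0 \<and> nu_gas g > 0 \<and>
     (if gamma_gas g = 1 then cv_gas g > 0 else cv_gas g = R_gas g / (gamma_gas g - 1))"

definition shear_visc :: "viscous_gas \<Rightarrow> real \<Rightarrow> real" where
  "shear_visc g \<theta> = alpha_gas g * \<theta> powr nu_gas g"

definition second_visc :: "viscous_gas \<Rightarrow> real \<Rightarrow> real" where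
  "second_visc g \<theta> = beta_gas g * \<theta> powr nu_gas g"

definition heat_cond :: "viscous_gas \<Rightarrow> real \<Rightarrow> real" where
  "heat_cond g \<theta> = daleth_gas g * \<theta> powr nu_gas g"

definition pressure :: "viscous_gas \<Rightarrow> real spacetime \<Rightarrow> real spacetime \<Rightarrow> real spacetime" where
  "pressure g \<rho> \<theta> t x = R_gas g * \<rho> t x * \<theta> t x"

definition internal_energy :: "viscous_gas \<Rightarrow> real spacetime \<Rightarrow> real spacetime" where
  "internal_energy g \<theta> t x = cv_gas g * \<theta> t x"

definition total_energy :: "viscous_gas \<Rightarrow> (real^3) spacetime \<Rightarrow> real spacetime \<Rightarrow> real spacetime" where
  "total_energy g u \<theta> t x = internal_energy g \<theta> t x + (norm (u t x))\<^sup>2 / 2"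

definition stress :: "viscous_gas \<Rightarrow> (real^3) spacetime \<Rightarrow> real spacetime \<Rightarrow> (real^3^3) spacetime" where
  "stress g u \<theta> t x =
     shear_visc g (\<theta> t x) *\<^sub>R (grad_vec u t x + transpose (grad_vec u t x))
     + (second_visc g (\<theta> t x) * div_vec u t x) *\<^sub>R mat 1"

text \<open>The equation of state \<open>P = A exp (S / c\<^sub>v) \<rho>\<^sup>\<gamma>\<close>; \<open>P = (\<gamma> - 1) \<rho> e\<close> follows from \<open>c\<^sub>v = R / (\<gamma> - 1)\<close>.
  For \<open>\<gamma> = 1\<close> only \<open>P = R \<rho> \<theta>\<close> and \<open>e = c\<^sub>v \<theta>\<close> are imposed.\<close>

definition entropy_law ::
  "viscous_gas \<Rightarrow> real set \<Rightarrow> real spacetime \<Rightarrow> real spacetime \<Rightarrow> real spacetime \<Rightarrow> bool" where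
  "entropy_law g I \<rho> \<theta> S \<longleftrightarrow>
     (gamma_gas g \<noteq> 1 \<longrightarrow>
       (\<forall>t\<in>I. \<forall>x. pressure g \<rho> \<theta> t x = A_gas g * exp (S t x / cv_gas g) * \<rho> t x powr gamma_gas g))"

definition mass_eq :: "real set \<Rightarrow> real spacetime \<Rightarrow> (real^3) spacetime \<Rightarrow> bool" where
  "mass_eq I \<rho> u \<longleftrightarrow>
     has_cont_dt I \<rho> \<and>
     (\<forall>j. has_cont_dx I j (\<lambda>t x. \<rho> t x * u t x $ j)) \<and>
     (\<forall>t\<in>I. \<forall>x. dt I \<rho> t x + div_vec (\<lambda>t x. \<rho> t x *\<^sub>R u t x) t x = 0)"

definition momentum_eq ::
  "viscous_gas \<Rightarrow> real set \<Rightarrow> real spacetime \<Rightarrow> (real^3) spacetime \<Rightarrow> real spacetime \<Rightarrow> bool" where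
  "momentum_eq g I \<rho> u \<theta> \<longleftrightarrow>
     has_cont_dt I (\<lambda>t x. \<rho> t x *\<^sub>R u t x) \<and>
     (\<forall>i j. has_cont_dx I j (\<lambda>t x. \<rho> t x * u t x $ i * u t x $ j)) \<and>
     (\<forall>j. has_cont_dx I j (pressure g \<rho> \<theta>)) \<and>
     (\<forall>i j. has_cont_dx I j (\<lambda>t x. u t x $ i)) \<and>
     (\<forall>i j. has_cont_dx I j (\<lambda>t x. stress g u \<theta> t x $ i $ j)) \<and>
     (\<forall>t\<in>I. \<forall>x.
        dt I (\<lambda>t x. \<rho> t x *\<^sub>R u t x) t x
        + div_mat (\<lambda>t x. \<rho> t x *\<^sub>R outer (u t x) (u t x)) t x
        + grad (pressure g \<rho> \<theta>) t x
        = div_mat (stress g u \<theta>) t x)"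

definition energy_eq ::
  "viscous_gas \<Rightarrow> real set \<Rightarrow> real spacetime \<Rightarrow> (real^3) spacetime \<Rightarrow> real spacetime \<Rightarrow> bool" where
  "energy_eq g I \<rho> u \<theta> \<longleftrightarrow>
     has_cont_dt I (\<lambda>t x. \<rho> t x * total_energy g u \<theta> t x) \<and>
     (\<forall>j. has_cont_dx I j
        (\<lambda>t x. (\<rho> t x * total_energy g u \<theta> t x + pressure g \<rho> \<theta> t x) * u t x $ j)) \<and>
     (\<forall>j. has_cont_dx I j (\<lambda>t x. (u t x v* stress g u \<theta> t x) $ j)) \<and>
     (\<forall>j. has_cont_dx I j \<theta>) \<and>
     (\<forall>j. has_cont_dx I j (\<lambda>t x. heat_cond g (\<theta> t x) * dx j \<theta> t x)) \<and>
     (\<forall>t\<in>I. \<forall>x.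
        dt I (\<lambda>t x. \<rho> t x * total_energy g u \<theta> t x) t x
        + div_vec (\<lambda>t x. (\<rho> t x * total_energy g u \<theta> t x) *\<^sub>R u t x
                        + pressure g \<rho> \<theta> t x *\<^sub>R u t x) t x
        = div_vec (\<lambda>t x. u t x v* stress g u \<theta> t x) t x
          + div_vec (\<lambda>t x. heat_cond g (\<theta> t x) *\<^sub>R grad \<theta> t x) t x)"

text \<open>\<open>S\<close> is carried along as a fourth unknown, tied to \<open>(\<rho>, \<theta>)\<close> by the entropy law. The sign
  \<open>\<theta> \<ge> 0\<close> is that of an absolute temperature and is what makes \<open>\<theta>\<close> to the power \<open>\<nu>\<close> meaningful.\<close>

definition classical_solution ::
  "viscous_gas \<Rightarrow> (real^3 \<Rightarrow> real) \<Rightarrow> (real^3 \<Rightarrow> real^3) \<Rightarrow> (real^3 \<Rightarrow> real) \<Rightarrow> real \<Rightarrow> real \<Rightarrow>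
   real spacetime \<Rightarrow> (real^3) spacetime \<Rightarrow> real spacetime \<Rightarrow> real spacetime \<Rightarrow> bool" where
  "classical_solution g \<rho>0 u0 S0 Sbar T \<rho> u \<theta> S \<longleftrightarrow>
     (\<forall>t\<in>{0..T}. \<forall>x. 0 \<le> \<rho> t x \<and> 0 \<le> \<theta> t x) \<and>
     entropy_law g {0..T} \<rho> \<theta> S \<and>
     mass_eq {0<..T} \<rho> u \<and>
     momentum_eq g {0<..T} \<rho> u \<theta> \<and>
     energy_eq g {0<..T} \<rho> u \<theta> \<and>
     (\<forall>x. \<rho> 0 x = \<rho>0 x \<and> u 0 x = u0 x \<and> S 0 x = S0 x) \<and>
     (\<forall>t\<in>{0..T}. ((\<lambda>x. (\<rho> t x, u t x, S t x)) \<longlongrightarrow> (0, 0, Sbar)) at_infinity)"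

section \<open>Conserved quantities and the solution class\<close>

definition total_mass :: "(real^3 \<Rightarrow> real) \<Rightarrow> real" where
  "total_mass r = (LINT x|lebesgue. r x)"

definition momentum :: "(real^3 \<Rightarrow> real) \<Rightarrow> (real^3 \<Rightarrow> real^3) \<Rightarrow> real^3" where
  "momentum r v = (LINT x|lebesgue. r x *\<^sub>R v x)"

definition kinetic_energy :: "(real^3 \<Rightarrow> real) \<Rightarrow> (real^3 \<Rightarrow> real^3) \<Rightarrow> real" where
  "kinetic_energy r v = (LINT x|lebesgue. r x * (norm (v x))\<^sup>2) / 2"

definition Linfty_norm :: "'a measure \<Rightarrow> ('a \<Rightarrow> 'b::real_normed_vector) \<Rightarrow> ereal" where
  "Linfty_norm M f = esssup M (\<lambda>x. ereal (norm (f x)))"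

definition Linfty :: "'a measure \<Rightarrow> ('a \<Rightarrow> 'b::real_normed_vector) set" where
  "Linfty M = {f \<in> borel_measurable M. Linfty_norm M f < \<infinity>}"

text \<open>The integrability clauses are needed because the Bochner integral of a non-integrable function
  is \<open>0\<close>. They are imposed at every time for mass and momentum, which are differentiated at every
  time, but only at almost every time for the kinetic energy, which merely lies in \<open>L\<^sup>\<infinity>\<close>.\<close>

definition class_D ::
  "viscous_gas \<Rightarrow> (real^3 \<Rightarrow> real) \<Rightarrow> (real^3 \<Rightarrow> real^3) \<Rightarrow> (real^3 \<Rightarrow> real) \<Rightarrow> real \<Rightarrow> real \<Rightarrow>
   real spacetime \<Rightarrow> (real^3) spacetime \<Rightarrow> real spacetime \<Rightarrow> real spacetime \<Rightarrow> bool" where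
  "class_D g \<rho>0 u0 S0 Sbar T \<rho> u \<theta> S \<longleftrightarrow>
     classical_solution g \<rho>0 u0 S0 Sbar T \<rho> u \<theta> S \<and>
     (\<forall>t\<in>{0..T}. integrable lebesgue (\<rho> t)) \<and>
     (\<forall>t\<in>{0..T}. integrable lebesgue (\<lambda>x. \<rho> t x *\<^sub>R u t x)) \<and>
     (AE t in lebesgue_on {0..T}. integrable lebesgue (\<lambda>x. \<rho> t x * (norm (u t x))\<^sup>2)) \<and>
     (\<lambda>t. total_mass (\<rho> t)) \<in> Linfty (lebesgue_on {0..T}) \<and>
     (\<lambda>t. momentum (\<rho> t) (u t)) \<in> Linfty (lebesgue_on {0..T}) \<and>
     (\<lambda>t. kinetic_energy (\<rho> t) (u t)) \<in> Linfty (lebesgue_on {0..T}) \<and>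
     (\<forall>t\<in>{0..T}. ((\<lambda>t. total_mass (\<rho> t)) has_vector_derivative 0) (at t within {0..T})) \<and>
     (\<forall>t\<in>{0..T}. ((\<lambda>t. momentum (\<rho> t) (u t)) has_vector_derivative 0) (at t within {0..T}))"

definition class_D_infinity ::
  "viscous_gas \<Rightarrow> (real^3 \<Rightarrow> real) \<Rightarrow> (real^3 \<Rightarrow> real^3) \<Rightarrow> (real^3 \<Rightarrow> real) \<Rightarrow> real \<Rightarrow>
   real spacetime \<Rightarrow> (real^3) spacetime \<Rightarrow> real spacetime \<Rightarrow> real spacetime \<Rightarrow> bool" where
  "class_D_infinity g \<rho>0 u0 S0 Sbar \<rho> u \<theta> S \<longleftrightarrow>
     (\<forall>T>0. class_D g \<rho>0 u0 S0 Sbar T \<rho> u \<theta> S)"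

end

theory Submission
  imports Defs
begin

text \<open>The obstruction is the conservation of momentum. Since \<open>\<rho> \<ge> 0\<close>, the momentum at time \<open>t\<close> is
  bounded by \<open>|u(t)|\<^sub>\<infinity> m(t)\<close> (\<open>norm_momentum_le_Linfty_mass\<close>). In the class \<open>D(\<infinity>)\<close> both the
  momentum and the mass keep their initial values \<open>P(0)\<close> and \<open>m(0)\<close>
  (\<open>class_D_mass_momentum_constant\<close>), so \<open>|u(t)|\<^sub>\<infinity> \<ge> |P(0)| / m(0) > 0\<close> for every \<open>t \<ge> 0\<close>, and
  the velocity cannot decay uniformly.\<close>

text \<open>Almost everywhere \<open>|v| \<le> c\<close>, so the nonnegative weight \<open>r\<close> gives \<open>|r v| \<le> c r\<close>, which
  integrates to the claim. A finite bound on the essential supremum already forces \<open>|v|\<close> to be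
  measurable, since \<^const>\<open>esssup\<close> is \<open>\<infinity>\<close> on all functions that are not.\<close>

lemma norm_momentum_le_Linfty_mass:
  assumes r: "integrable lebesgue r" "\<And>x. 0 \<le> r x"
    and rv: "integrable lebesgue (\<lambda>x. r x *\<^sub>R v x)"
    and bound: "Linfty_norm lebesgue v \<le> ereal c"
  shows "norm (momentum r v) \<le> c * total_mass r"
proof -
  have "AE x in lebesgue. ereal (norm (v x)) \<le> Linfty_norm lebesgue v"
    unfolding Linfty_norm_def by (rule esssup_AE)
  then have ae: "AE x in lebesgue. norm (r x *\<^sub>R v x) \<le> c * r x"
  proof eventually_elim
    case (elim x)
    with bound have "norm (v x) \<le> c"
      by (metis ereal_less_eq(3) order_trans)
    with r(2)[of x] show ?case
      by (simp add: mult.commute[of c] mult_left_mono)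
  qed
  have "norm (momentum r v) \<le> (LINT x|lebesgue. norm (r x *\<^sub>R v x))"
    unfolding momentum_def by (rule integral_norm_bound)
  also have "\<dots> \<le> (LINT x|lebesgue. c * r x)"
    using rv r(1) ae by (intro integral_mono_AE integrable_norm integrable_mult_right)
  also have "\<dots> = c * total_mass r"
    by (simp add: total_mass_def)
  finally show ?thesis .
qed

lemma zero_derivative_imp_eq_initial:
  fixes f :: "real \<Rightarrow> 'a::real_normed_vector"
  assumes "\<forall>s\<in>{0..T}. (f has_vector_derivative 0) (at s within {0..T})" and t: "t \<in> {0..T}"
  shows "f t = f 0"
proof -
  obtain k where "\<And>s. s \<in> {0..T} \<Longrightarrow> f s = k"
    using has_vector_derivative_zero_constant[of "{0..T}" f] assms(1) by auto
  with t show ?thesis by auto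
qed

lemma class_D_mass_momentum_constant:
  assumes D: "class_D g \<rho>0 u0 S0 Sbar T \<rho> u \<theta> S" and t: "t \<in> {0..T}"
  shows "total_mass (\<rho> t) = total_mass \<rho>0" "momentum (\<rho> t) (u t) = momentum \<rho>0 u0"
proof -
  have init: "\<rho> 0 = \<rho>0" "u 0 = u0"
    using D by (auto simp: class_D_def classical_solution_def)
  have "\<forall>s\<in>{0..T}. ((\<lambda>t. total_mass (\<rho> t)) has_vector_derivative 0) (at s within {0..T})"
    using D unfolding class_D_def by blast
  from zero_derivative_imp_eq_initial[OF this t] show "total_mass (\<rho> t) = total_mass \<rho>0"
    by (simp only: init)
  have "\<forall>s\<in>{0..T}. ((\<lambda>t. momentum (\<rho> t) (u t)) has_vector_derivative 0) (at s within {0..T})"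
    using D unfolding class_D_def by blast
  from zero_derivative_imp_eq_initial[OF this t] show "momentum (\<rho> t) (u t) = momentum \<rho>0 u0"
    by (simp only: init)
qed

theorem theorem1p2:
  fixes g :: viscous_gas
    and \<rho>0 :: "real^3 \<Rightarrow> real" and u0 :: "real^3 \<Rightarrow> real^3" and S0 :: "real^3 \<Rightarrow> real"
    and Sbar :: real
  assumes "polytropic g"
    and "\<forall>x. \<rho>0 x > 0"
    and "total_mass \<rho>0 > 0"
    and "norm (momentum \<rho>0 u0) > 0"
    and "gamma_gas g \<ge> 1"
    and "\<forall>\<theta>\<ge>0. shear_visc g \<theta> \<ge> 0"
    and "\<forall>\<theta>\<ge>0. 2 * shear_visc g \<theta> + 3 * second_visc g \<theta> \<ge> 0"
    and "\<forall>\<theta>\<ge>0. heat_cond g \<theta> \<ge> 0"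
  shows "\<not> (\<exists>\<rho> u \<theta> S. class_D_infinity g \<rho>0 u0 S0 Sbar \<rho> u \<theta> S \<and>
           Limsup at_top (\<lambda>t. Linfty_norm lebesgue (u t)) = 0)"
proof
  assume "\<exists>\<rho> u \<theta> S. class_D_infinity g \<rho>0 u0 S0 Sbar \<rho> u \<theta> S \<and>
           Limsup at_top (\<lambda>t. Linfty_norm lebesgue (u t)) = 0"
  then obtain \<rho> u \<theta> S where D: "class_D_infinity g \<rho>0 u0 S0 Sbar \<rho> u \<theta> S"
    and lim: "Limsup at_top (\<lambda>t. Linfty_norm lebesgue (u t)) = 0" by blast
  \<comment> \<open>Half of the lower bound for the velocity, so that a non-strict estimate already contradicts it.\<close>
  define c where "c = norm (momentum \<rho>0 u0) / (2 * total_mass \<rho>0)"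
  have "c > 0" using assms(3,4) by (simp add: c_def)
  with lim have "eventually (\<lambda>t. Linfty_norm lebesgue (u t) < ereal c) at_top"
    by (intro Limsup_lessD) simp
  then have "eventually (\<lambda>t. Linfty_norm lebesgue (u t) < ereal c \<and> t > 0) at_top"
    by (intro eventually_conj eventually_gt_at_top)
  then obtain t where small: "Linfty_norm lebesgue (u t) < ereal c" and t: "t > 0"
    using eventually_happens'[OF trivial_limit_at_top_linorder] by blast
  from D t have Dt: "class_D g \<rho>0 u0 S0 Sbar t \<rho> u \<theta> S"
    by (simp add: class_D_infinity_def)
  have "norm (momentum (\<rho> t) (u t)) \<le> c * total_mass (\<rho> t)"
  proof (rule norm_momentum_le_Linfty_mass)
    show "integrable lebesgue (\<rho> t)" "integrable lebesgue (\<lambda>x. \<rho> t x *\<^sub>R u t x)"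
      "\<And>x. 0 \<le> \<rho> t x"
      using Dt t by (auto simp: class_D_def classical_solution_def)
    show "Linfty_norm lebesgue (u t) \<le> ereal c" using small by simp
  qed
  moreover have "total_mass (\<rho> t) = total_mass \<rho>0" "momentum (\<rho> t) (u t) = momentum \<rho>0 u0"
    using class_D_mass_momentum_constant[OF Dt, of t] t by auto
  ultimately have "norm (momentum \<rho>0 u0) \<le> c * total_mass \<rho>0" by simp
  also have "\<dots> = norm (momentum \<rho>0 u0) / 2"
    using assms(3) by (simp add: c_def)
  finally show False using assms(4) by linarith
qed

end
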